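(* Treedepth and pathwidth (with their canonical hyperparameterisations) are awful; that is, for $\rho\in\{\mathrm{td},\mathrm{pw}\}$ there exists a graph class that has clique-bounded $\rho$ but does not have bounded $\alpha\text{-}\rho$.
   Context: All graphs are finite, simple and undirected; $\alpha$ and $\omega$ denote independence and clique number. A graph class is a set of graphs closed under isomorphism. For a graph parameter $\sigma$, a class $\mathcal G$ has bounded $\sigma$ if there is an integer $c$ with $\sigma(G')\le c$ for every induced subgraph $G'$ of every $G\in\mathcal G$; it has clique-bounded $\sigma$ if there is a nondecreasing function $f$ with $\sigma(G')\le f(\omega(G'))$ for every induced subgraph $G'$ of every $G\in\mathcal G$. A path decomposition of $G$ is a pair $(P,\beta)$ with $P$ a path and bags $\beta(x)\subseteq V(G)$ such that every vertex is in some bag, every edge has both ends in a common bag, and for each vertex the nodes containing it form a subpath. Pathwidth $\mathrm{pw}(G)$ is the minimum over path decompositions of the maximum bag size $\max_x|\beta(x)|$, and $\alpha\text{-}\mathrm{pw}(G)$ is the minimum over path decompositions of $\max_x\alpha(G[\beta(x)])$. A treedepth decomposition of $G$ is a rooted forest $F$ on $V(G)$ such that $G$ is a subgraph of the graph obtained from $F$ by making each root-to-leaf path a clique; $\mathrm{td}(G)$ is the minimum over treedepth decompositions of the maximum number of vertices of a root-to-leaf path, and $\alpha\text{-}\mathrm{td}(G)$ is the minimum over treedepth decompositions $F$ of $\max \alpha(G[V(Q)])$ over root-to-leaf paths $Q$ of $F$. A basic parameter $\rho$ is called awesome if, for every graph class, clique-bounded $\rho$ is equivalent to bounded $\alpha\text{-}\rho$,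 and awful otherwise. *)

theory Defs
  imports Main "HOL-Library.Ramsey"
begin

section \<open>Graphs\<close>

text \<open>
  A graph is a pair of a vertex set and a set of edges, the edges being two-element sets of
  vertices. The predicates \<^const>\<open>clique\<close> and \<^const>\<open>indep\<close> are those of
  \<^theory>\<open>HOL-Library.Ramsey\<close>.
\<close>

type_synonym 'a graph = "'a set \<times> 'a set set"

abbreviation verts :: "'a graph \<Rightarrow> 'a set" where "verts G \<equiv> fst G"
abbreviation edges :: "'a graph \<Rightarrow> 'a set set" where "edges G \<equiv> snd G"

definition fin_graph :: "'a graph \<Rightarrow> bool" where
  "fin_graph G \<longleftrightarrow> finite (verts G) \<and> edges G \<subseteq> [verts G]\<^bsup>2\<^esup>"

definition induced :: "'a graph \<Rightarrow> 'a set \<Rightarrow> 'a graph" where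
  "induced G S = (verts G \<inter> S, {e \<in> edges G. e \<subseteq> S})"

definition induced_subgraph :: "'a graph \<Rightarrow> 'a graph \<Rightarrow> bool" where
  "induced_subgraph H G \<longleftrightarrow> (\<exists>S \<subseteq> verts G. H = induced G S)"

definition graph_iso :: "'a graph \<Rightarrow> 'b graph \<Rightarrow> bool" where
  "graph_iso G H \<longleftrightarrow> (\<exists>f. bij_betw f (verts G) (verts H) \<and>
     (\<forall>u \<in> verts G. \<forall>v \<in> verts G. {u, v} \<in> edges G \<longleftrightarrow> {f u, f v} \<in> edges H))"

definition alpha :: "'a graph \<Rightarrow> nat" where
  "alpha G = Max {card S |S. S \<subseteq> verts G \<and> indep S (edges G)}"

definition omega :: "'a graph \<Rightarrow> nat" where
  "omega G = Max {card S |S. S \<subseteq> verts G \<and> clique S (edges G)}"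


section \<open>Path decompositions\<close>

text \<open>
  A path decomposition is given by the list of its bags, read along the path. The list is
  nonempty because a path has at least one node; subpaths are the nonempty intervals of
  positions. As in the source, widths are bag sizes, without subtracting one.
\<close>

definition path_decomp :: "'a graph \<Rightarrow> 'a set list \<Rightarrow> bool" where
  "path_decomp G B \<longleftrightarrow>
     B \<noteq> [] \<and> (\<forall>X \<in> set B. X \<subseteq> verts G) \<and>
     (\<forall>v \<in> verts G. \<exists>X \<in> set B. v \<in> X) \<and>
     (\<forall>e \<in> edges G. \<exists>X \<in> set B. e \<subseteq> X) \<and>
     (\<forall>v \<in> verts G. \<exists>a b. a \<le> b \<and> b < length B \<and> {i. i < length B \<and> v \<in> B ! i} = {a..b})"

text \<open>
  On \<^typ>\<open>nat\<close>, \<open>INF\<close> over a nonempty set is a minimum.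
\<close>

definition pw :: "'a graph \<Rightarrow> nat" where
  "pw G = (INF B \<in> {B. path_decomp G B}. MAX X \<in> set B. card X)"

definition alpha_pw :: "'a graph \<Rightarrow> nat" where
  "alpha_pw G = (INF B \<in> {B. path_decomp G B}. MAX X \<in> set B. alpha (induced G X))"


section \<open>Treedepth decompositions\<close>

text \<open>
  A rooted forest on the vertex set \<open>V\<close> is given by its parent relation: \<open>(x, y) \<in> R\<close> means that
  \<open>y\<close> is the parent of \<open>x\<close>. The roots are the vertices without parent, the leaves those without
  child; an isolated vertex is both.
\<close>

definition rooted_forest :: "'a set \<Rightarrow> ('a \<times> 'a) set \<Rightarrow> bool" where
  "rooted_forest V R \<longleftrightarrow> R \<subseteq> V \<times> V \<and> single_valued R \<and> acyclic R"

definition root_leaf_path :: "'a set \<Rightarrow> ('a \<times> 'a) set \<Rightarrow> 'a list \<Rightarrow> bool" where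
  "root_leaf_path V R Q \<longleftrightarrow>
     Q \<noteq> [] \<and> set Q \<subseteq> V \<and> successively (\<lambda>x y. (y, x) \<in> R) Q \<and>
     hd Q \<notin> Domain R \<and> last Q \<notin> Range R"

definition forest_closure :: "'a set \<Rightarrow> ('a \<times> 'a) set \<Rightarrow> 'a graph" where
  "forest_closure V R = (V, \<Union>Q \<in> {Q. root_leaf_path V R Q}. [set Q]\<^bsup>2\<^esup>)"

definition td_decomp :: "'a graph \<Rightarrow> ('a \<times> 'a) set \<Rightarrow> bool" where
  "td_decomp G R \<longleftrightarrow>
     rooted_forest (verts G) R \<and> edges G \<subseteq> edges (forest_closure (verts G) R)"

text \<open>
  The maximum over root-to-leaf paths is written \<open>SUP\<close> so that it is \<open>0\<close> for the empty forest; a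
  finite forest has finitely many root-to-leaf paths, so otherwise it is a maximum.
\<close>

definition td :: "'a graph \<Rightarrow> nat" where
  "td G = (INF R \<in> {R. td_decomp G R}.
     SUP Q \<in> {Q. root_leaf_path (verts G) R Q}. card (set Q))"

definition alpha_td :: "'a graph \<Rightarrow> nat" where
  "alpha_td G = (INF R \<in> {R. td_decomp G R}.
     SUP Q \<in> {Q. root_leaf_path (verts G) R Q}. alpha (induced G (set Q)))"


section \<open>Graph classes\<close>

text \<open>
  Every finite graph is isomorphic to one with vertices in \<^typ>\<open>nat\<close>, so classes of finite graphs
  are represented by sets of graphs on natural numbers.
\<close>

definition graph_class :: "nat graph set \<Rightarrow> bool" where
  "graph_class \<G> \<longleftrightarrow> (\<forall>G \<in> \<G>. fin_graph G) \<and>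
     (\<forall>G \<in> \<G>. \<forall>H. fin_graph H \<and> graph_iso G H \<longrightarrow> H \<in> \<G>)"

definition has_bounded :: "(nat graph \<Rightarrow> nat) \<Rightarrow> nat graph set \<Rightarrow> bool" where
  "has_bounded \<sigma> \<G> \<longleftrightarrow> (\<exists>c. \<forall>G \<in> \<G>. \<forall>H. induced_subgraph H G \<longrightarrow> \<sigma> H \<le> c)"

definition has_clique_bounded :: "(nat graph \<Rightarrow> nat) \<Rightarrow> nat graph set \<Rightarrow> bool" where
  "has_clique_bounded \<sigma> \<G> \<longleftrightarrow>
     (\<exists>f :: nat \<Rightarrow> nat. mono f \<and>
       (\<forall>G \<in> \<G>. \<forall>H. induced_subgraph H G \<longrightarrow> \<sigma> H \<le> f (omega H)))"

text \<open>
  The second argument is the hyperparameterisation of the first by the independence number.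
\<close>

definition awesome :: "(nat graph \<Rightarrow> nat) \<Rightarrow> (nat graph \<Rightarrow> nat) \<Rightarrow> bool" where
  "awesome \<rho> \<alpha>\<rho> \<longleftrightarrow>
     (\<forall>\<G>. graph_class \<G> \<longrightarrow> (has_clique_bounded \<rho> \<G> \<longleftrightarrow> has_bounded \<alpha>\<rho> \<G>))"

abbreviation awful :: "(nat graph \<Rightarrow> nat) \<Rightarrow> (nat graph \<Rightarrow> nat) \<Rightarrow> bool" where
  "awful \<rho> \<alpha>\<rho> \<equiv> \<not> awesome \<rho> \<alpha>\<rho>"

end

theory Submission
  imports Defs "HOL-Library.Nat_Bijection"
begin

text \<open>
  One class serves both parameters. Let \<open>G\<^sub>0\<close> be empty, and obtain \<open>G\<^sub>k\<^sub>+\<^sub>1\<close> from three disjoint copies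
  \<open>T\<^sub>0, T\<^sub>1, T\<^sub>2\<close> of \<open>G\<^sub>k\<close> and a triangle \<open>x\<^sub>0, x\<^sub>1, x\<^sub>2\<close>, with \<open>x\<^sub>i\<close> complete to \<open>T\<^sub>j\<close> for \<open>i \<noteq> j\<close> and
  anticomplete to \<open>T\<^sub>i\<close>. An induced subgraph \<open>H\<close> has treedepth and pathwidth at most \<open>2 \<omega>(H)\<close>: if
  \<open>H\<close> contains \<open>m \<ge> 2\<close> vertices of the triangle, then deleting them lowers the bound by \<open>m\<close>, while
  every part \<open>H \<inter> T\<^sub>j\<close> has clique number at most \<open>\<omega>(H) - (m - 1)\<close>; if \<open>m = 1\<close>, then the part that
  does not see the triangle vertex is a union of components.

  Conversely every decomposition of \<open>G\<^sub>k\<close> has a bag or a root-to-leaf path with \<open>k\<close> independent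
  vertices. By induction \<open>T\<^sub>j\<close> has such a set of size \<open>k - 1\<close>, and as all of it is adjacent to \<open>x\<^sub>i\<close>
  for \<open>i \<noteq> j\<close>, for a suitable \<open>j\<close> it can be extended by \<open>x\<^sub>j\<close>.
\<close>

section \<open>Induced subgraphs, clique number and independence number\<close>

lemma fst_induced [simp]: "verts (induced G S) = verts G \<inter> S"
  by (simp add: induced_def)

lemma snd_induced [simp]: "edges (induced G S) = {e \<in> edges G. e \<subseteq> S}"
  by (simp add: induced_def)

lemma induced_induced: "induced (induced G A) B = induced G (A \<inter> B)"
  by (auto simp: induced_def)

lemma fin_graph_edgeD:
  assumes "fin_graph G" "e \<in> edges G"
  obtains u v where "e = {u, v}" "u \<noteq> v" "u \<in> verts G" "v \<in> verts G"
proof -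
  have "e \<subseteq> verts G" "card e = 2" using assms by (auto simp: fin_graph_def nsets_def)
  then show ?thesis using that by (auto simp: card_2_iff)
qed

lemma induced_verts:
  assumes "fin_graph G" shows "induced G (verts G) = G"
  using assms by (auto simp: induced_def prod_eq_iff fin_graph_def nsets_def)

lemma fin_graph_induced:
  assumes "fin_graph G" shows "fin_graph (induced G S)"
  using assms by (simp add: fin_graph_def nsets_def subset_iff) blast

lemma finite_card_subsets: "finite V \<Longrightarrow> finite {card S |S. S \<subseteq> V \<and> p S}"
  by (rule finite_subset[of _ "card ` Pow V"]) auto

lemma card_le_omega:
  assumes "finite (verts G)" "S \<subseteq> verts G" "clique S (edges G)"
  shows "card S \<le> omega G"
  unfolding omega_def using assms by (intro Max_ge finite_card_subsets) auto

lemma card_le_alpha: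
  assumes "finite (verts G)" "S \<subseteq> verts G" "indep S (edges G)"
  shows "card S \<le> alpha G"
  unfolding alpha_def using assms by (intro Max_ge finite_card_subsets) auto

lemma omega_witness:
  assumes "finite (verts G)"
  obtains S where "S \<subseteq> verts G" "clique S (edges G)" "card S = omega G"
proof -
  have "{card S |S. S \<subseteq> verts G \<and> clique S (edges G)} \<noteq> {}"
    by (auto intro!: exI[of _ "{}"] simp: clique_def)
  from Max_in[OF finite_card_subsets[OF assms] this] show ?thesis
    using that unfolding omega_def by (smt (verit) mem_Collect_eq)
qed

lemma omega_induced_le:
  assumes "fin_graph G" shows "omega (induced G S) \<le> omega G"
proof -
  have fin: "finite (verts G)" "finite (verts (induced G S))"
    using assms by (auto simp: fin_graph_def)
  obtain C where "C \<subseteq> verts (induced G S)" "clique C (edges (induced G S))"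
    "card C = omega (induced G S)"
    using omega_witness[OF fin(2)] .
  then show ?thesis using card_le_omega[OF fin(1), of C] by (auto simp: clique_def)
qed


section \<open>A graph on words\<close>

text \<open>
  The word \<open>[j]\<close> stands for \<open>x\<^sub>j\<close> and the words \<open>j # w\<close> with \<open>w\<close> nonempty for the vertices of \<open>T\<^sub>j\<close>.
\<close>

fun adj :: "nat list \<Rightarrow> nat list \<Rightarrow> bool" where
  "adj (i # u) (j # v) = (if i = j then adj u v else u = [] \<or> v = [])"
| "adj _ _ = False"

lemma adj_Nil2 [simp]: "\<not> adj u []"
  by (cases u) auto

lemma adj_irrefl [simp]: "\<not> adj u u"
  by (induction u) auto

lemma adj_sym: "adj u v \<Longrightarrow> adj v u"
  by (induction u v rule: adj.induct) (auto split: if_splits)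

text \<open>An embedding as an induced subgraph into the infinite graph of all nonempty words. As
  lengths are not bounded, one hereditary class contains every \<open>G_k\<close>.\<close>

definition word_labelling :: "('a \<Rightarrow> nat list) \<Rightarrow> 'a graph \<Rightarrow> bool" where
  "word_labelling f G \<longleftrightarrow> inj_on f (verts G) \<and> [] \<notin> f ` verts G \<and>
     (\<forall>u \<in> verts G. \<forall>v \<in> verts G. {u, v} \<in> edges G \<longleftrightarrow> adj (f u) (f v))"

definition word_graphs :: "nat graph set" where
  "word_graphs = {G. fin_graph G \<and> (\<exists>f. word_labelling f G)}"

lemma word_labelling_induced: "word_labelling f G \<Longrightarrow> word_labelling f (induced G S)"
  by (auto simp: word_labelling_def inj_on_def)

lemma word_labelling_iso:
  assumes "word_labelling f G" "graph_iso G H"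
  shows "\<exists>g. word_labelling g H"
proof -
  obtain h where h: "bij_betw h (verts G) (verts H)"
    "\<forall>u \<in> verts G. \<forall>v \<in> verts G. {u, v} \<in> edges G \<longleftrightarrow> {h u, h v} \<in> edges H"
    using assms(2) by (auto simp: graph_iso_def)
  let ?i = "inv_into (verts G) h"
  have i: "bij_betw ?i (verts H) (verts G)" using h(1) by (rule bij_betw_inv_into)
  have i_in: "?i v \<in> verts G" and hi: "h (?i v) = v" if "v \<in> verts H" for v
    using that h(1) i by (auto simp: bij_betw_inv_into_right bij_betw_apply)
  have "inj_on (f \<circ> ?i) (verts H)"
    using assms(1) i by (auto simp: word_labelling_def bij_betw_def intro!: comp_inj_on)
  moreover have "[] \<notin> (f \<circ> ?i) ` verts H"
    using assms(1) i_in by (force simp: word_labelling_def)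
  moreover have "{u, v} \<in> edges H \<longleftrightarrow> adj ((f \<circ> ?i) u) ((f \<circ> ?i) v)"
    if "u \<in> verts H" "v \<in> verts H" for u v
    using assms(1) h(2) i_in[OF that(1)] i_in[OF that(2)] hi[OF that(1)] hi[OF that(2)]
    unfolding word_labelling_def comp_def by metis
  ultimately show ?thesis unfolding word_labelling_def by blast
qed

lemma graph_class_word_graphs: "graph_class word_graphs"
  unfolding graph_class_def word_graphs_def using word_labelling_iso by blast

lemma induced_subgraph_word_graphs:
  "G \<in> word_graphs \<Longrightarrow> induced_subgraph H G \<Longrightarrow> H \<in> word_graphs"
  unfolding induced_subgraph_def word_graphs_def
  using fin_graph_induced word_labelling_induced by blast


section \<open>Width bounds in terms of the clique number\<close>

text \<open>The properties shared by pathwidth and treedepth on which the upper bound rests: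
  splitting along components costs nothing, an added vertex costs one. The bound is thereby proved
  once for both.\<close>

locale width =
  fixes width_le :: "'a graph \<Rightarrow> nat \<Rightarrow> bool"
  assumes width_mono: "width_le G w \<Longrightarrow> w \<le> w' \<Longrightarrow> width_le G w'"
    and width_empty: "width_le ({}, {}) 0"
    and width_Un: "\<lbrakk>fin_graph G; width_le (induced G A) w; width_le (induced G (- A)) w;
          \<And>e. e \<in> edges G \<Longrightarrow> e \<subseteq> A \<or> e \<subseteq> - A\<rbrakk> \<Longrightarrow> width_le G w"
    and width_insert: "\<lbrakk>fin_graph G; v \<in> verts G; width_le (induced G (- {v})) w\<rbrakk>
          \<Longrightarrow> width_le G (Suc w)"
begin

lemma width_no_verts:
  assumes "fin_graph G" "verts G = {}" shows "width_le G w"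
proof -
  have "G = ({}, {})"
    using assms by (auto simp: prod_eq_iff elim: fin_graph_edgeD)
  then show ?thesis using width_mono[OF width_empty] by simp
qed

text \<open>Iterates \<open>width_Un\<close>: the class of one vertex is split off, and the rest has
  fewer vertices. In the rest, the class just removed is empty.\<close>

lemma width_colour_classes:
  assumes "fin_graph G"
    and "\<And>u v. {u, v} \<in> edges G \<Longrightarrow> c u = c v"
    and "\<And>j. width_le (induced G {v. c v = j}) w"
  shows "width_le G w"
  using assms
proof (induction "card (verts G)" arbitrary: G rule: less_induct)
  case less
  show ?case
  proof (cases "verts G = {}")
    case True
    then show ?thesis using less.prems(1) width_no_verts by blast
  next
    case False
    then obtain x where x: "x \<in> verts G" by blast
    let ?A = "{v. c v = c x}"
    have "card (verts (induced G (- ?A))) < card (verts G)"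
      using x less.prems(1) by (auto simp: fin_graph_def intro!: psubset_card_mono)
    moreover have "width_le (induced (induced G (- ?A)) {v. c v = j}) w" for j
    proof (cases "j = c x")
      case True
      then show ?thesis using less.prems(1)
        by (intro width_no_verts fin_graph_induced) auto
    next
      case False
      then have "- ?A \<inter> {v. c v = j} = {v. c v = j}" by auto
      then show ?thesis using less.prems(3)[of j] by (simp add: induced_induced)
    qed
    moreover have "c u = c v" if "{u, v} \<in> edges (induced G (- ?A))" for u v
      using less.prems(2) that by simp
    ultimately have "width_le (induced G (- ?A)) w"
      using less.hyps fin_graph_induced[OF less.prems(1)] by blast
    then show ?thesis
    proof (rule width_Un[OF less.prems(1,3)])
      fix e assume e: "e \<in> edges G"
      obtain u v where "e = {u, v}" using fin_graph_edgeD[OF less.prems(1) e] by metis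
      then show "e \<subseteq> ?A \<or> e \<subseteq> - ?A" using less.prems(2)[of u v] e by simp
    qed
  qed
qed

lemma width_insert_set:
  assumes "finite K" "fin_graph G" "K \<subseteq> verts G" "width_le (induced G (- K)) w"
  shows "width_le G (w + card K)"
  using assms
proof (induction K arbitrary: w)
  case empty
  then show ?case by (simp add: induced_def)
next
  case (insert x K)
  have eq: "induced (induced G (- K)) (- {x}) = induced G (- insert x K)"
    unfolding induced_induced by (rule arg_cong[of _ _ "induced G"]) auto
  have "width_le (induced G (- K)) (Suc w)"
    by (rule width_insert[of _ x]) (use insert eq in \<open>auto intro: fin_graph_induced\<close>)
  from insert.IH[OF insert.prems(1) _ this] insert show ?case by simp
qed

text \<open>Induction on the maximal word length, since dropping the first letter turns each part
  \<open>T j\<close> into a smaller instance. Letters are arbitrary naturals here, so the triangle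
  becomes a clique \<open>K\<close> of any size.\<close>

lemma width_le_twice_omega:
  assumes "fin_graph G" "word_labelling f G"
  shows "width_le G (2 * omega G)"
proof -
  have "finite (f ` verts G)" using assms(1) by (simp add: fin_graph_def)
  then obtain n where "\<forall>v \<in> verts G. length (f v) \<le> n"
    using finite_maxlen[of "f ` verts G"] by (auto intro: less_imp_le)
  then show ?thesis using assms
  proof (induction n arbitrary: G f)
    case 0
    then have "verts G = {}" by (auto simp: word_labelling_def)
    then show ?case using "0.prems"(2) width_no_verts by blast
  next
    case (Suc n)
    note fin = Suc.prems(2)
    have finV: "finite (verts G)" using fin by (simp add: fin_graph_def)
    have inj: "inj_on f (verts G)"
      and ne: "\<And>v. v \<in> verts G \<Longrightarrow> f v \<noteq> []"
      and edge: "\<And>u v. u \<in> verts G \<Longrightarrow> v \<in> verts G \<Longrightarrow> {u, v} \<in> edges G \<longleftrightarrow> adj (f u) (f v)"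
      using Suc.prems(3) by (auto simp: word_labelling_def image_iff)
    \<comment> \<open>\<open>K\<close> collects the vertices \<open>x_j\<close> present in
      \<open>G\<close>, and \<open>T j\<close> is the part of \<open>G\<close> inside the copy with
      letter \<open>j\<close>.\<close>
    define c where "c v = hd (f v)" for v
    define K where "K = {v \<in> verts G. tl (f v) = []}"
    define T where "T j = - K \<inter> {v. c v = j}" for j
    have f_eq: "f v = c v # tl (f v)" if "v \<in> verts G" for v
      using ne[OF that] by (simp add: c_def)
    have edge': "{u, v} \<in> edges G \<longleftrightarrow>
        (if c u = c v then adj (tl (f u)) (tl (f v)) else u \<in> K \<or> v \<in> K)"
      if "u \<in> verts G" "v \<in> verts G" for u v
    proof -
      have "adj (f u) (f v) \<longleftrightarrow> adj (c u # tl (f u)) (c v # tl (f v))"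
        by (simp only: f_eq[OF that(1), symmetric] f_eq[OF that(2), symmetric])
      then show ?thesis using edge[OF that] that by (simp add: K_def)
    qed
    have c_inj: "u = v" if "u \<in> K" "v \<in> K" "c u = c v" for u v
    proof -
      have "f u = f v" using that f_eq[of u] f_eq[of v] by (simp add: K_def)
      then show ?thesis using that inj by (auto simp: K_def inj_on_def)
    qed
    have c_const: "c u = c v" if e: "{u, v} \<in> edges G" and "u \<notin> K" "v \<notin> K" for u v
    proof -
      have "u \<in> verts G" "v \<in> verts G" using e fin by (auto elim!: fin_graph_edgeD simp: doubleton_eq_iff)
      then show ?thesis using edge'[of u v] that by (auto split: if_splits)
    qed
    have KV: "K \<subseteq> verts G" "finite K" using finV by (auto simp: K_def)
    have wT: "width_le (induced G (T j)) (2 * omega (induced G (T j)))" for j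
    proof (rule Suc.IH[where f = "\<lambda>v. tl (f v)"])
      show "\<forall>v \<in> verts (induced G (T j)). length (tl (f v)) \<le> n"
        using Suc.prems(1) by auto
      show "fin_graph (induced G (T j))" using fin by (rule fin_graph_induced)
      have "inj_on (\<lambda>v. tl (f v)) (verts (induced G (T j)))"
      proof (rule inj_onI)
        fix u v assume "u \<in> verts (induced G (T j))" "v \<in> verts (induced G (T j))"
          "tl (f u) = tl (f v)"
        then show "u = v" using f_eq[of u] f_eq[of v] inj
          by (auto simp: T_def inj_on_def)
      qed
      then show "word_labelling (\<lambda>v. tl (f v)) (induced G (T j))"
        using edge' by (auto simp: word_labelling_def T_def K_def)
    qed
    \<comment> \<open>Vertices of \<open>K\<close> with a letter other than \<open>j\<close> see all
      of \<open>T j\<close> and each other, so a largest clique of \<open>T j\<close> extends by all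
      of them.\<close>
    have omT: "omega (induced G (T j)) + card (K - {v. c v = j}) \<le> omega G" for j
    proof -
      have "finite (verts (induced G (T j)))" using finV by simp
      then obtain C where C: "C \<subseteq> verts (induced G (T j))" "clique C (edges (induced G (T j)))"
        "card C = omega (induced G (T j))"
        by (rule omega_witness)
      have CT: "C \<subseteq> verts G" "C \<subseteq> T j" using C(1) by auto
      have "clique (C \<union> (K - {v. c v = j})) (edges G)"
        unfolding clique_def
      proof (intro ballI impI)
        fix u v assume uv: "u \<in> C \<union> (K - {v. c v = j})" "v \<in> C \<union> (K - {v. c v = j})" "u \<noteq> v"
        show "{u, v} \<in> edges G"
        proof (cases "u \<in> C \<and> v \<in> C")
          case True
          then show ?thesis using C(2) uv(3) by (auto simp: clique_def)
        next
          case False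
          then have "c u \<noteq> c v" "u \<in> K \<or> v \<in> K"
            using uv c_inj CT(2) by (auto simp: T_def)
          then show ?thesis using edge'[of u v] uv CT(1) KV(1) by auto
        qed
      qed
      then have "card (C \<union> (K - {v. c v = j})) \<le> omega G"
        using CT(1) KV(1) by (intro card_le_omega finV) auto
      moreover have "C \<inter> (K - {v. c v = j}) = {}" using CT(2) by (auto simp: T_def)
      moreover have "finite C" using CT(1) finV finite_subset by blast
      ultimately show ?thesis using C(3) KV(2) by (simp add: card_Un_disjoint)
    qed
    \<comment> \<open>Edges outside \<open>K\<close> keep the first letter, so the letters split
      this part into unions of components. \<open>X\<close> will be \<open>- A\<close> if
      \<open>K\<close> is a single vertex and \<open>UNIV\<close> otherwise.\<close>
    have classes: "width_le (induced G (- K \<inter> X)) w"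
      if "\<And>j. width_le (induced G (- K \<inter> X \<inter> {v. c v = j})) w" for X w
    proof (rule width_colour_classes[where c = c])
      show "fin_graph (induced G (- K \<inter> X))" using fin by (rule fin_graph_induced)
      show "c u = c v" if "{u, v} \<in> edges (induced G (- K \<inter> X))" for u v
        using c_const[of u v] that by simp
    qed (simp add: induced_induced that)
    show ?case
    proof (cases "card K = 1")
      case True
      then obtain x where x: "K = {x}" by (auto simp: card_1_singleton_iff)
      \<comment> \<open>The copy with the letter of \<open>x\<close> is not seen by
        \<open>x\<close>, hence is a union of components. It is split off before \<open>x\<close> is
        paid for, because its clique number may equal that of \<open>G\<close>.\<close>
      define A where "A = T (c x)"
      have xV: "x \<in> verts G" "tl (f x) = []" using x by (auto simp: K_def)
      have A1: "width_le (induced G A) (2 * omega G)"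
        using wT[of "c x"] omega_induced_le[OF fin, of A] unfolding A_def
        by (elim width_mono) simp
      have "width_le (induced G (- K \<inter> - A \<inter> {v. c v = j})) (2 * omega G - 2)" for j
      proof (cases "j = c x")
        case True
        then show ?thesis using fin
          by (intro width_no_verts fin_graph_induced) (auto simp: A_def T_def)
      next
        case False
        then have "- K \<inter> - A \<inter> {v. c v = j} = T j" "K - {v. c v = j} = {x}"
          by (auto simp: A_def T_def x)
        then show ?thesis using wT[of j] omT[of j] width_mono by simp
      qed
      from classes[OF this] have "width_le (induced (induced G (- A)) (- {x})) (2 * omega G - 2)"
        by (simp add: induced_induced x Int_commute)
      then have "width_le (induced G (- A)) (Suc (2 * omega G - 2))"
        using xV fin x by (intro width_insert[of _ x] fin_graph_induced) (auto simp: A_def T_def)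
      \<comment> \<open>The subtraction in \<open>2 * omega G - 2\<close> is therefore not
        truncated, and adding \<open>x\<close> stays within the bound.\<close>
      moreover have "1 \<le> omega G"
        using card_le_omega[OF finV, of "{x}"] xV by (simp add: clique_def)
      ultimately have A2: "width_le (induced G (- A)) (2 * omega G)"
        by (elim width_mono) simp
      show ?thesis
      proof (rule width_Un[OF fin A1 A2])
        fix e assume e: "e \<in> edges G"
        obtain u v where uv: "e = {u, v}" "u \<in> verts G" "v \<in> verts G"
          using fin_graph_edgeD[OF fin e] by metis
        have "\<not> (u \<in> A \<and> v \<notin> A)" "\<not> (v \<in> A \<and> u \<notin> A)"
          using e edge'[OF uv(2,3)] uv(1) xV(2) by (auto simp: A_def T_def x split: if_splits)
        then show "e \<subseteq> A \<or> e \<subseteq> - A" using uv(1) by auto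
      qed
    next
      case False
      have cardK: "card K \<le> Suc (card (K - {v. c v = j}))" for j
      proof -
        have "card (K \<inter> {v. c v = j}) \<le> 1"
          using c_inj KV(2) by (auto simp: card_le_Suc0_iff_eq)
        moreover have "card K = card (K - {v. c v = j}) + card (K \<inter> {v. c v = j})"
          using KV(2) by (metis add.commute card_Int_Diff)
        ultimately show ?thesis by simp
      qed
      have "clique K (edges G)" unfolding clique_def
        using edge' c_inj KV(1) by (metis subsetD)
      then have Kom: "card K \<le> omega G" using card_le_omega finV KV(1) by blast
      have "width_le (induced G (- K \<inter> UNIV \<inter> {v. c v = j})) (2 * omega G - card K)" for j
      proof -
        \<comment> \<open>A letter occurs at most once in \<open>K\<close>, so for
          \<open>m = card K\<close> the clique number drops by at least \<open>m - 1\<close>. Twice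
          that is at least \<open>m\<close> if \<open>m \<ge> 2\<close>, and \<open>m = 0\<close> is
          trivial.\<close>
        have "2 * omega (induced G (T j)) \<le> 2 * omega G - card K"
          using omT[of j] cardK[of j] False by linarith
        from width_mono[OF wT[of j] this] show ?thesis by (simp add: T_def)
      qed
      from classes[OF this] have "width_le (induced G (- K)) (2 * omega G - card K)" by simp
      from width_insert_set[OF KV(2) fin KV(1) this] Kom show ?thesis by simp
    qed
  qed
qed

end


section \<open>Path decompositions\<close>

text \<open>Besides bounding \<open>pw\<close>, it supplies a decomposition, hence the nonemptiness
  needed to bound an \<open>INF\<close> from below.\<close>

definition pw_le :: "'a graph \<Rightarrow> nat \<Rightarrow> bool" where
  "pw_le G w \<longleftrightarrow> (\<exists>B. path_decomp G B \<and> (\<forall>X \<in> set B. card X \<le> w))"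

lemma pw_leI: "pw_le G w \<Longrightarrow> pw G \<le> w"
proof -
  assume "pw_le G w"
  then obtain B where B: "path_decomp G B" "\<forall>X \<in> set B. card X \<le> w" by (auto simp: pw_le_def)
  have "pw G \<le> (MAX X \<in> set B. card X)"
    unfolding pw_def using B by (intro cINF_lower) auto
  also have "\<dots> \<le> w" using B by (auto simp: path_decomp_def)
  finally show ?thesis .
qed

lemma path_decomp_interval:
  assumes "path_decomp G B" "v \<in> verts G"
  obtains a b where "a \<le> b" "b < length B" "{i. i < length B \<and> v \<in> B ! i} = {a..b}"
proof -
  have "\<exists>a b. a \<le> b \<and> b < length B \<and> {i. i < length B \<and> v \<in> B ! i} = {a..b}"
    using assms by (simp add: path_decomp_def)
  then show ?thesis using that by blast
qed

text \<open>Each vertex lives in only one of the two lists, so its interval is kept or shifted by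
  \<open>length B\<close>.\<close>

lemma path_decomp_append:
  assumes fin: "fin_graph G"
    and B: "path_decomp (induced G A) B" and C: "path_decomp (induced G (- A)) C"
    and e: "\<And>e. e \<in> edges G \<Longrightarrow> e \<subseteq> A \<or> e \<subseteq> - A"
  shows "path_decomp G (B @ C)"
  unfolding path_decomp_def
proof (intro conjI ballI)
  show "B @ C \<noteq> []" using B by (auto simp: path_decomp_def)
  show "X \<subseteq> verts G" if "X \<in> set (B @ C)" for X
    using B C that by (force simp: path_decomp_def)
  show "\<exists>X \<in> set (B @ C). v \<in> X" if "v \<in> verts G" for v
  proof -
    have "\<exists>X \<in> set B. v \<in> X" if "v \<in> A"
      using B that \<open>v \<in> verts G\<close> by (simp add: path_decomp_def)
    moreover have "\<exists>X \<in> set C. v \<in> X" if "v \<notin> A"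
      using C that \<open>v \<in> verts G\<close> by (simp add: path_decomp_def)
    ultimately show ?thesis by auto
  qed
  show "\<exists>X \<in> set (B @ C). d \<subseteq> X" if "d \<in> edges G" for d
  proof -
    have "\<exists>X \<in> set B. d \<subseteq> X" if "d \<subseteq> A"
      using B that \<open>d \<in> edges G\<close> by (simp add: path_decomp_def)
    moreover have "\<exists>X \<in> set C. d \<subseteq> X" if "d \<subseteq> - A"
      using C that \<open>d \<in> edges G\<close> by (simp add: path_decomp_def)
    ultimately show ?thesis using e[OF that] by auto
  qed
  fix v assume v: "v \<in> verts G"
  show "\<exists>a b. a \<le> b \<and> b < length (B @ C) \<and> {i. i < length (B @ C) \<and> v \<in> (B @ C) ! i} = {a..b}"
  proof (cases "v \<in> A")
    case True
    then obtain a b where ab: "a \<le> b" "b < length B" "{i. i < length B \<and> v \<in> B ! i} = {a..b}"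
      using path_decomp_interval[OF B, of v] v by auto
    have vC: "v \<notin> C ! i" if "i < length C" for i
      using C True nth_mem[OF that] by (auto simp: path_decomp_def)
    have "i < length (B @ C) \<and> v \<in> (B @ C) ! i \<longleftrightarrow> i < length B \<and> v \<in> B ! i" for i
      using vC[of "i - length B"] by (cases "i < length B") (simp_all add: nth_append less_diff_conv2)
    then have "{i. i < length (B @ C) \<and> v \<in> (B @ C) ! i} = {i. i < length B \<and> v \<in> B ! i}"
      by (rule Collect_cong)
    then have "{i. i < length (B @ C) \<and> v \<in> (B @ C) ! i} = {a..b}" using ab(3) by simp
    moreover have "b < length (B @ C)" using ab(2) by simp
    ultimately show ?thesis using ab(1) by blast
  next
    case False
    then obtain a b where ab: "a \<le> b" "b < length C" "{i. i < length C \<and> v \<in> C ! i} = {a..b}"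
      using path_decomp_interval[OF C, of v] v by auto
    have "v \<notin> B ! i" if "i < length B" for i
      using B False nth_mem[OF that] by (auto simp: path_decomp_def)
    then have "{i. i < length (B @ C) \<and> v \<in> (B @ C) ! i}
        = (+) (length B) ` {i. i < length C \<and> v \<in> C ! i}"
      by (auto simp: nth_append image_iff split: if_splits)
         (metis add_diff_inverse_nat nat_add_left_cancel_less)
    then have "{i. i < length (B @ C) \<and> v \<in> (B @ C) ! i} = {length B + a..length B + b}"
      using ab(3) by simp
    moreover have "length B + a \<le> length B + b" "length B + b < length (B @ C)" using ab by auto
    ultimately show ?thesis by blast
  qed
qed

text \<open>With \<open>v\<close> in every bag, its interval is the whole path, and an edge at
  \<open>v\<close> is covered by any bag of its other end.\<close>

lemma path_decomp_insert:
  assumes fin: "fin_graph G" and v: "v \<in> verts G" and B: "path_decomp (induced G (- {v})) B"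
  shows "path_decomp G (map (insert v) B)"
  unfolding path_decomp_def
proof (intro conjI ballI)
  show ne: "map (insert v) B \<noteq> []" using B by (auto simp: path_decomp_def)
  show "X \<subseteq> verts G" if "X \<in> set (map (insert v) B)" for X
    using B v that by (force simp: path_decomp_def)
  have bag: "\<exists>X \<in> set B. u \<in> X" if "u \<in> verts G" "u \<noteq> v" for u
    using B that by (auto simp: path_decomp_def)
  show "\<exists>X \<in> set (map (insert v) B). u \<in> X" if "u \<in> verts G" for u
    using bag[OF that] ne by (cases "u = v") (auto simp: ex_in_conv)
  show "\<exists>X \<in> set (map (insert v) B). e \<subseteq> X" if e: "e \<in> edges G" for e
  proof (cases "v \<in> e")
    case True
    then obtain u where "e = {v, u}" "u \<noteq> v" "u \<in> verts G"
      using fin_graph_edgeD[OF fin e] by (metis insert_commute insertE singletonD)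
    then show ?thesis using bag[of u] by auto
  next
    case False
    then have "\<exists>X \<in> set B. e \<subseteq> X" using B e by (auto simp: path_decomp_def)
    then show ?thesis by auto
  qed
  fix u assume u: "u \<in> verts G"
  let ?I = "{i. i < length (map (insert v) B) \<and> u \<in> map (insert v) B ! i}"
  show "\<exists>a b. a \<le> b \<and> b < length (map (insert v) B) \<and> ?I = {a..b}"
  proof (cases "u = v")
    case True
    then have "?I = {..<length B}" by auto
    also have "\<dots> = {0..length B - 1}" using ne by (cases B) auto
    finally have "?I = {0..length B - 1}" .
    moreover have "length B - 1 < length (map (insert v) B)" using ne by simp
    ultimately show ?thesis by blast
  next
    case False
    then have "?I = {i. i < length B \<and> u \<in> B ! i}" by auto
    moreover have "u \<in> verts (induced G (- {v}))" using u False by simp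
    ultimately show ?thesis by (elim path_decomp_interval[OF B]) auto
  qed
qed

interpretation pw: width pw_le
proof
  show "pw_le G w \<Longrightarrow> w \<le> w' \<Longrightarrow> pw_le G w'" for G :: "'a graph" and w w'
    by (force simp: pw_le_def)
  \<comment> \<open>A decomposition has at least one bag, so the witness is a single empty
    one.\<close>
  show "pw_le (({}, {}) :: 'a graph) 0"
    by (auto simp: pw_le_def path_decomp_def intro!: exI[of _ "[{}]"])
  show "pw_le G w" if "fin_graph G" "pw_le (induced G A) w" "pw_le (induced G (- A)) w"
    "\<And>e. e \<in> edges G \<Longrightarrow> e \<subseteq> A \<or> e \<subseteq> - A" for G :: "'a graph" and A w
    using that path_decomp_append[of G A] unfolding pw_le_def by (metis UnE set_append)
  show "pw_le G (Suc w)" if G: "fin_graph G" "v \<in> verts G" "pw_le (induced G (- {v})) w"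
    for G :: "'a graph" and v w
  proof -
    obtain B where B: "path_decomp (induced G (- {v})) B" "\<forall>X \<in> set B. card X \<le> w"
      using G(3) by (auto simp: pw_le_def)
    have "card (insert v X) \<le> Suc w" if "X \<in> set B" for X
      using B(2) that by (intro order.trans[OF card_insert_le_m1[of "Suc w"]]) auto
    then show ?thesis using path_decomp_insert[OF G(1,2) B(1)]
      unfolding pw_le_def by (intro exI[of _ "map (insert v) B"]) auto
  qed
qed


section \<open>Treedepth decompositions\<close>

text \<open>Makes the \<open>SUP\<close> in \<open>alpha_td\<close> bounded: its values depend only
  on the vertex sets of the paths.\<close>

lemma finite_root_leaf_image:
  assumes "finite V" shows "finite ((\<lambda>Q. h (set Q)) ` {Q. root_leaf_path V R Q})"
  by (rule finite_subset[of _ "h ` Pow V"]) (use assms in \<open>auto simp: root_leaf_path_def\<close>)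

text \<open>\<open>R\<close> points from child to parent: its well-foundedness yields leaves below a
  vertex, that of the converse allows induction from the roots downwards.\<close>

lemma rooted_forest_wf:
  assumes "finite V" "rooted_forest V R"
  shows "wf R" "wf (R\<inverse>)"
proof -
  have "finite R" using assms finite_subset[of R "V \<times> V"] by (auto simp: rooted_forest_def)
  then show "wf R" "wf (R\<inverse>)" using assms
    by (auto simp: rooted_forest_def finite_acyclic_wf intro: finite_acyclic_wf_converse)
qed

text \<open>The path to the parent is extended by \<open>x\<close>. As the parent is unique, every
  other ancestor of \<open>x\<close> is the parent or an ancestor of it.\<close>

lemma root_path_exists:
  assumes "finite V" "rooted_forest V R" "x \<in> V"
  shows "\<exists>Q. Q \<noteq> [] \<and> set Q \<subseteq> V \<and> successively (\<lambda>x y. (y, x) \<in> R) Q \<and>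
     hd Q \<notin> Domain R \<and> last Q = x \<and> {y. (x, y) \<in> R\<^sup>*} \<subseteq> set Q"
  using rooted_forest_wf(2)[OF assms(1,2)] assms(3)
proof (induction x rule: wf_induct_rule)
  case (less x)
  show ?case
  proof (cases "x \<in> Domain R")
    case False
    then have "{y. (x, y) \<in> R\<^sup>*} \<subseteq> {x}" by (auto elim: converse_rtranclE)
    then show ?thesis using False less.prems by (intro exI[of _ "[x]"]) auto
  next
    case True
    then obtain p where p: "(x, p) \<in> R" by blast
    then have "p \<in> V" using assms(2) by (auto simp: rooted_forest_def)
    then obtain Q where Q: "Q \<noteq> []" "set Q \<subseteq> V" "successively (\<lambda>x y. (y, x) \<in> R) Q"
      "hd Q \<notin> Domain R" "last Q = p" "{y. (p, y) \<in> R\<^sup>*} \<subseteq> set Q"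
      using less.IH[of p] p by auto
    have "y = x \<or> (p, y) \<in> R\<^sup>*" if "(x, y) \<in> R\<^sup>*" for y
    proof (rule converse_rtranclE[OF that])
      fix z assume "(x, z) \<in> R" "(z, y) \<in> R\<^sup>*"
      then show ?thesis using single_valuedD[of R x z p] p assms(2)
        by (simp add: rooted_forest_def)
    qed simp
    then show ?thesis using Q p less.prems
      by (intro exI[of _ "Q @ [x]"]) (auto simp: successively_append_iff)
  qed
qed

text \<open>A minimal descendant \<open>l\<close> of \<open>x\<close> is a leaf, and the ancestors
  of \<open>x\<close> are among those of \<open>l\<close>.\<close>

lemma root_leaf_path_exists:
  assumes "finite V" "rooted_forest V R" "x \<in> V"
  obtains Q where "root_leaf_path V R Q" "{y. (x, y) \<in> R\<^sup>*} \<subseteq> set Q"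
proof -
  obtain l where l: "(l, x) \<in> R\<^sup>*" "\<And>y. (y, l) \<in> R \<Longrightarrow> (y, x) \<notin> R\<^sup>*"
    using wfE_min[OF rooted_forest_wf(1)[OF assms(1,2)], of x "{l. (l, x) \<in> R\<^sup>*}"] by auto
  have leaf: "l \<notin> Range R" using l by (meson Range.cases converse_rtrancl_into_rtrancl)
  have "l \<in> V" using l(1) assms(2,3)
    by (auto simp: rooted_forest_def elim: converse_rtranclE)
  then obtain Q where Q: "Q \<noteq> []" "set Q \<subseteq> V" "successively (\<lambda>x y. (y, x) \<in> R) Q"
      "hd Q \<notin> Domain R" "last Q = l" "{y. (l, y) \<in> R\<^sup>*} \<subseteq> set Q"
    using root_path_exists[OF assms(1,2)] by blast
  show ?thesis
  proof (rule that)
    show "root_leaf_path V R Q" using Q leaf by (simp add: root_leaf_path_def)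
    show "{y. (x, y) \<in> R\<^sup>*} \<subseteq> set Q" using Q(6) l(1) by (auto intro: rtrancl_trans)
  qed
qed

text \<open>Turns an edge of the \<open>forest_closure\<close> into an ancestor relation.\<close>

lemma successively_comparable:
  assumes "successively (\<lambda>x y. (y, x) \<in> R) Q" "x \<in> set Q" "y \<in> set Q"
  shows "(x, y) \<in> R\<^sup>* \<or> (y, x) \<in> R\<^sup>*"
proof -
  have "sorted_wrt (\<lambda>x y. (y, x) \<in> R\<^sup>*) Q"
    using assms(1)
    by (intro successively_conv_sorted_wrt[THEN iffD1])
       (auto intro!: transpI elim: successively_mono)
  then show ?thesis using assms(2,3)
    by (induction Q) auto
qed

section \<open>Combining treedepth decompositions\<close>

definition td_le :: "'a graph \<Rightarrow> nat \<Rightarrow> bool" where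
  "td_le G w \<longleftrightarrow>
     (\<exists>R. td_decomp G R \<and> (\<forall>Q. root_leaf_path (verts G) R Q \<longrightarrow> card (set Q) \<le> w))"

lemma td_leI:
  assumes "td_le G w" shows "td G \<le> w"
proof -
  obtain R where R: "td_decomp G R" "\<And>Q. root_leaf_path (verts G) R Q \<Longrightarrow> card (set Q) \<le> w"
    using assms by (auto simp: td_le_def)
  let ?P = "{Q. root_leaf_path (verts G) R Q}"
  have "td G \<le> (SUP Q \<in> ?P. card (set Q))"
    unfolding td_def using R by (intro cINF_lower) auto
  \<comment> \<open>Without vertices there is no path, and the \<open>SUP\<close> takes its default
    value \<open>0\<close>.\<close>
  also have "\<dots> \<le> w"
    using R by (cases "?P = {}") (auto intro!: cSUP_least simp del: Collect_empty_eq)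
  finally show ?thesis .
qed

lemma td_decomp_Un:
  assumes fin: "fin_graph G"
    and R: "td_decomp (induced G A) R" and S: "td_decomp (induced G (- A)) S"
    and e: "\<And>e. e \<in> edges G \<Longrightarrow> e \<subseteq> A \<or> e \<subseteq> - A"
  shows "td_decomp G (R \<union> S)"
    and "root_leaf_path (verts G) (R \<union> S) Q \<Longrightarrow>
      root_leaf_path (verts G \<inter> A) R Q \<or> root_leaf_path (verts G - A) S Q"
proof -
  have finV: "finite (verts G \<inter> A)" "finite (verts G - A)" using fin by (auto simp: fin_graph_def)
  have rf: "rooted_forest (verts G \<inter> A) R" "rooted_forest (verts G - A) S"
    using R S by (auto simp: td_decomp_def Diff_eq)
  have sub: "R \<subseteq> (verts G \<inter> A) \<times> (verts G \<inter> A)" "S \<subseteq> (verts G - A) \<times> (verts G - A)"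
    using rf by (auto simp: rooted_forest_def)
  have "wf (R \<union> S)"
    using sub by (intro wf_Un rooted_forest_wf[OF finV(1) rf(1)] rooted_forest_wf[OF finV(2) rf(2)]) auto
  then have rfG: "rooted_forest (verts G) (R \<union> S)"
    unfolding rooted_forest_def
  proof (intro conjI)
    have "single_valued R" "single_valued S" using rf by (auto simp: rooted_forest_def)
    moreover have "Domain R \<inter> Domain S = {}" using sub by blast
    ultimately show "single_valued (R \<union> S)" unfolding single_valued_def by blast
  qed (use sub wf_acyclic in \<open>auto\<close>)
  have pR: "root_leaf_path (verts G) (R \<union> S) Q" if "root_leaf_path (verts G \<inter> A) R Q" for Q
  proof -
    have Q: "Q \<noteq> []" "set Q \<subseteq> verts G \<inter> A" "successively (\<lambda>x y. (y, x) \<in> R) Q"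
      "hd Q \<notin> Domain R" "last Q \<notin> Range R"
      using that by (auto simp: root_leaf_path_def)
    then have "hd Q \<in> verts G \<inter> A" "last Q \<in> verts G \<inter> A" by (meson hd_in_set last_in_set subsetD)+
    moreover have "successively (\<lambda>x y. (y, x) \<in> R \<union> S) Q"
      using Q(3) by (rule successively_mono) simp
    ultimately show ?thesis using Q sub by (auto simp: root_leaf_path_def)
  qed
  have pS: "root_leaf_path (verts G) (R \<union> S) Q" if "root_leaf_path (verts G - A) S Q" for Q
  proof -
    have Q: "Q \<noteq> []" "set Q \<subseteq> verts G - A" "successively (\<lambda>x y. (y, x) \<in> S) Q"
      "hd Q \<notin> Domain S" "last Q \<notin> Range S"
      using that by (auto simp: root_leaf_path_def)
    then have "hd Q \<in> verts G - A" "last Q \<in> verts G - A" by (meson hd_in_set last_in_set subsetD)+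
    moreover have "successively (\<lambda>x y. (y, x) \<in> R \<union> S) Q"
      using Q(3) by (rule successively_mono) simp
    ultimately show ?thesis using Q sub by (auto simp: root_leaf_path_def)
  qed
  have "d \<in> edges (forest_closure (verts G) (R \<union> S))" if d: "d \<in> edges G" for d
  proof -
    have "d \<in> edges (forest_closure (verts G \<inter> A) R) \<or> d \<in> edges (forest_closure (verts G - A) S)"
      using R S e[OF d] d by (auto simp: td_decomp_def Diff_eq)
    then show ?thesis using pR pS by (auto simp: forest_closure_def)
  qed
  then show "td_decomp G (R \<union> S)" using rfG by (auto simp: td_decomp_def)
  \<comment> \<open>\<open>R\<close> and \<open>S\<close> live on disjoint vertex sets, so
    consecutive links cannot change sides.\<close>
  have side: "set Q \<subseteq> A \<and> successively (\<lambda>x y. (y, x) \<in> R) Q \<or>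
      set Q \<subseteq> - A \<and> successively (\<lambda>x y. (y, x) \<in> S) Q"
    if "successively (\<lambda>x y. (y, x) \<in> R \<union> S) Q" for Q
    using that
  proof (induction Q rule: induct_list012)
    case (3 x y zs)
    then show ?case using sub by auto
  qed auto
  show "root_leaf_path (verts G \<inter> A) R Q \<or> root_leaf_path (verts G - A) S Q"
    if "root_leaf_path (verts G) (R \<union> S) Q"
    using that side[of Q] by (auto simp: root_leaf_path_def)
qed

text \<open>\<open>v\<close> becomes the parent of all old roots, which are the vertices outside
  \<open>Domain R\<close>. Each path thus grows by one vertex; \<open>P\<close> is empty when
  \<open>v\<close> is the only vertex.\<close>

lemma td_decomp_insert:
  fixes G :: "'a graph"
  assumes fin: "fin_graph G" and v: "v \<in> verts G" and R: "td_decomp (induced G (- {v})) R"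
  defines "S \<equiv> R \<union> (verts G - {v} - Domain R) \<times> {v}"
  shows "td_decomp G S"
    and "root_leaf_path (verts G) S Q \<Longrightarrow> \<exists>P. Q = v # P \<and>
      (P = [] \<or> root_leaf_path (verts G - {v}) R P)"
proof -
  let ?V = "verts G - {v}"
  have finV: "finite ?V" using fin by (auto simp: fin_graph_def)
  have rf: "rooted_forest ?V R" using R by (auto simp: td_decomp_def Diff_eq)
  have sub: "R \<subseteq> ?V \<times> ?V" using rf by (auto simp: rooted_forest_def)
  have "wf ((?V - Domain R) \<times> {v})" unfolding wf_def by blast
  then have "wf S" unfolding S_def
    using sub by (intro wf_Un rooted_forest_wf[OF finV rf]) auto
  then have rfG: "rooted_forest (verts G) S"
    using rf sub v wf_acyclic[of S] unfolding rooted_forest_def single_valued_def S_def by blast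
  have ext: "root_leaf_path (verts G) S (v # Q)" if Q: "root_leaf_path ?V R Q" for Q
  proof -
    have Q': "Q \<noteq> []" "hd Q \<notin> Domain R" "last Q \<notin> Range R"
      "set Q \<subseteq> ?V" "successively (\<lambda>x y. (y, x) \<in> R) Q"
      using Q by (auto simp: root_leaf_path_def)
    then have "hd Q \<in> ?V" "last Q \<in> ?V" by (meson hd_in_set last_in_set subsetD)+
    have "successively (\<lambda>x y. (y, x) \<in> S) Q" using Q'(5)
      by (rule successively_mono) (auto simp: S_def)
    then show ?thesis using Q' \<open>hd Q \<in> ?V\<close> \<open>last Q \<in> ?V\<close> v sub
      by (auto simp: root_leaf_path_def S_def successively_Cons)
  qed
  have "e \<in> edges (forest_closure (verts G) S)" if e: "e \<in> edges G" for e
  proof (cases "v \<in> e")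
    case True
    then obtain u where u: "e = {v, u}" "u \<noteq> v" "u \<in> verts G"
      using fin_graph_edgeD[OF fin e] by (metis insert_commute insertE singletonD)
    then obtain Q where "root_leaf_path ?V R Q" "{y. (u, y) \<in> R\<^sup>*} \<subseteq> set Q"
      using root_leaf_path_exists[OF finV rf, of u] by auto
    then have "root_leaf_path (verts G) S (v # Q)" "e \<in> [set (v # Q)]\<^bsup>2\<^esup>"
      using ext u by (auto simp: nsets_def)
    then show ?thesis by (auto simp: forest_closure_def)
  next
    case False
    then have "e \<in> edges (forest_closure ?V R)" using R e by (auto simp: td_decomp_def Diff_eq)
    then obtain Q where "root_leaf_path ?V R Q" "e \<in> [set Q]\<^bsup>2\<^esup>"
      by (auto simp: forest_closure_def)
    then have "root_leaf_path (verts G) S (v # Q)" "e \<in> [set (v # Q)]\<^bsup>2\<^esup>"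
      using ext by (auto simp: nsets_def)
    then show ?thesis unfolding forest_closure_def snd_conv by blast
  qed
  then show "td_decomp G S" using rfG by (auto simp: td_decomp_def)
  show "\<exists>P. Q = v # P \<and> (P = [] \<or> root_leaf_path ?V R P)"
    if Q: "root_leaf_path (verts G) S Q"
  proof -
    have "hd Q \<in> verts G" "hd Q \<notin> Domain S"
      using Q by (auto simp: root_leaf_path_def intro: subsetD[OF _ hd_in_set])
    then have "hd Q = v" by (auto simp: S_def)
    then obtain P where P: "Q = v # P" using Q by (cases Q) (auto simp: root_leaf_path_def)
    \<comment> \<open>Every child in \<open>S\<close> differs from \<open>v\<close>, so the path
      never returns to \<open>v\<close>, and all links after the first come from
      \<open>R\<close>.\<close>
    have tail: "set P \<subseteq> ?V \<and> successively (\<lambda>x y. (y, x) \<in> R) P"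
      if "successively (\<lambda>x y. (y, x) \<in> S) (x # P)" for x
      using that
    proof (induction P arbitrary: x)
      case (Cons y P)
      have "(y, x) \<in> S" "successively (\<lambda>x y. (y, x) \<in> S) (y # P)" using Cons.prems by auto
      moreover from this have IH: "set P \<subseteq> ?V" "successively (\<lambda>x y. (y, x) \<in> R) P"
        using Cons.IH by auto
      moreover have "(hd P, y) \<in> R" if "P \<noteq> []"
        using that calculation(1,2) sub by (cases P) (auto simp: S_def)
      ultimately show ?case using sub by (auto simp: S_def successively_Cons)
    qed auto
    have "root_leaf_path ?V R P" if "P \<noteq> []"
    proof -
      have "(hd P, v) \<in> S" using Q that unfolding P root_leaf_path_def
        by (cases P) auto
      then have "hd P \<notin> Domain R" using sub by (auto simp: S_def)
      moreover have "last P \<notin> Range R" using Q that by (auto simp: P root_leaf_path_def S_def)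
      ultimately show ?thesis using tail[of v] Q that by (auto simp: P root_leaf_path_def)
    qed
    then show ?thesis using P by blast
  qed
qed

interpretation td: width td_le
proof
  show "td_le G w \<Longrightarrow> w \<le> w' \<Longrightarrow> td_le G w'" for G :: "'a graph" and w w'
    by (force simp: td_le_def)
  show "td_le (({}, {}) :: 'a graph) 0"
    by (auto simp: td_le_def td_decomp_def rooted_forest_def root_leaf_path_def wf_acyclic intro!: exI[of _ "{}"])
  show "td_le G w" if "fin_graph G" "td_le (induced G A) w" "td_le (induced G (- A)) w"
    "\<And>e. e \<in> edges G \<Longrightarrow> e \<subseteq> A \<or> e \<subseteq> - A" for G :: "'a graph" and A w
    using that td_decomp_Un[of G A] unfolding td_le_def fst_induced Diff_eq by metis
  show "td_le G (Suc w)" if G: "fin_graph G" "v \<in> verts G" "td_le (induced G (- {v})) w"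
    for G :: "'a graph" and v w
  proof -
    obtain R where R: "td_decomp (induced G (- {v})) R"
      "\<And>Q. root_leaf_path (verts G - {v}) R Q \<Longrightarrow> card (set Q) \<le> w"
      using G(3) by (auto simp: td_le_def Diff_eq)
    let ?S = "R \<union> (verts G - {v} - Domain R) \<times> {v}"
    have "card (set Q) \<le> Suc w" if "root_leaf_path (verts G) ?S Q" for Q
      using td_decomp_insert(2)[OF G(1,2) R(1) that] R(2)
      by (auto simp: card_insert_if le_SucI)
    then show ?thesis using td_decomp_insert(1)[OF G(1,2) R(1)] unfolding td_le_def by blast
  qed
qed


section \<open>Independent sets in bags and on root-to-leaf paths\<close>

text \<open>The vertices of \<open>G_k\<close>: three letters for the three copies, the length bound
  for the number of recursion levels.\<close>

definition words :: "nat \<Rightarrow> nat list set" where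
  "words k = {w. w \<noteq> [] \<and> length w \<le> k \<and> set w \<subseteq> {0, 1, 2}}"

lemma Cons_words: "w \<in> words k \<Longrightarrow> j \<in> {0, 1, 2} \<Longrightarrow> j # w \<in> words (Suc k)"
  by (auto simp: words_def)

lemma singleton_words: "j \<in> {0, 1, 2} \<Longrightarrow> [j] \<in> words (Suc k)"
  by (auto simp: words_def)

lemma finite_words: "finite (words k)"
  by (rule finite_subset[OF _ finite_lists_length_le[of "{0, 1, 2}" k]]) (auto simp: words_def)

definition indep_words :: "nat \<Rightarrow> nat list set \<Rightarrow> bool" where
  "indep_words k S \<longleftrightarrow> S \<subseteq> words k \<and> card S = k \<and> (\<forall>u \<in> S. \<forall>v \<in> S. \<not> adj u v)"

text \<open>\<open>x_j\<close> is anticomplete to \<open>T_j\<close>: after removing the common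
  letter, one of the two words is empty.\<close>

lemma indep_words_Suc:
  assumes "indep_words k S" "j \<in> {0, 1, 2}"
  shows "indep_words (Suc k) (insert [j] ((#) j ` S))"
proof -
  have "finite S" using assms(1) finite_words finite_subset by (auto simp: indep_words_def)
  moreover have "[j] \<notin> (#) j ` S" using assms(1) by (auto simp: indep_words_def words_def)
  ultimately have "card (insert [j] ((#) j ` S)) = Suc k"
    using assms(1) by (simp add: card_image indep_words_def)
  then show ?thesis
    using assms Cons_words singleton_words by (auto simp: indep_words_def)
qed

text \<open>
  Let \<open>t j\<close> be a position at which the intervals of the independent set of \<open>T\<^sub>j\<close> meet. If the interval
  of \<open>x\<^sub>j\<close> misses \<open>t j\<close> on the same side for two letters \<open>j\<close>, then one of the two sets can be moved
  to the end of the interval of its \<open>x\<^sub>j\<close>. Among three letters two miss on the same side, or some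
  \<open>x\<^sub>j\<close> does not miss.
\<close>

lemma indep_words_interval:
  fixes a b :: "nat list \<Rightarrow> nat"
  assumes "\<And>w. w \<in> words k \<Longrightarrow> a w \<le> b w"
    and "\<And>u v. u \<in> words k \<Longrightarrow> v \<in> words k \<Longrightarrow> adj u v \<Longrightarrow> a u \<le> b v"
  shows "\<exists>S t. indep_words k S \<and> (\<forall>w \<in> S. a w \<le> t \<and> t \<le> b w)"
  using assms
proof (induction k arbitrary: a b)
  case 0
  then show ?case by (intro exI[of _ "{}"]) (auto simp: indep_words_def)
next
  case (Suc k)
  let ?J = "{0, 1, 2 :: nat}"
  have "\<exists>S t. indep_words k S \<and> (\<forall>w \<in> S. a (j # w) \<le> t \<and> t \<le> b (j # w))" if j: "j \<in> ?J" for j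
    using Suc.IH[of "\<lambda>w. a (j # w)" "\<lambda>w. b (j # w)"] Suc.prems j Cons_words[of _ k j] by fastforce
  then obtain S t where S: "\<And>j. j \<in> ?J \<Longrightarrow> indep_words k (S j)"
    and t: "\<And>j w. j \<in> ?J \<Longrightarrow> w \<in> S j \<Longrightarrow> a (j # w) \<le> t j \<and> t j \<le> b (j # w)"
    by metis
  \<comment> \<open>It suffices to find a point \<open>p\<close> common to \<open>x_j\<close> and
    the independent set of its copy.\<close>
  have good: ?case if "j \<in> ?J" "a [j] \<le> p" "p \<le> b [j]" "\<And>w. w \<in> S j \<Longrightarrow> a (j # w) \<le> p \<and> p \<le> b (j # w)" for j p
    using that indep_words_Suc[OF S that(1)] singleton_words[OF that(1), of k]
    by (intro exI[of _ "insert [j] ((#) j ` S j)"] exI[of _ p]) auto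
  have meet: "a [i] \<le> b (j # w)" "a (j # w) \<le> b [i]" if "i \<in> ?J" "j \<in> ?J" "i \<noteq> j" "w \<in> S j" for i j w
  proof -
    have "w \<in> words k" using S that by (auto simp: indep_words_def)
    then show "a [i] \<le> b (j # w)" "a (j # w) \<le> b [i]"
      using that Suc.prems(2) Cons_words singleton_words by auto
  qed
  \<comment> \<open>The point is \<open>b [j]\<close>. Each interval of the set in
    \<open>T_j\<close> reaches right to \<open>t j\<close>, beyond \<open>b [j]\<close>, and starts
    by \<open>b [i] \<le> b [j]\<close> because it meets that of \<open>x_i\<close>.\<close>
  have right: ?case if "i \<in> ?J" "j \<in> ?J" "i \<noteq> j" "b [i] < t i" "b [j] < t j" "b [i] \<le> b [j]" for i j
  proof (rule good[OF that(2), of "b [j]"])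
    show "a [j] \<le> b [j]" using Suc.prems(1) singleton_words that by blast
    show "a (j # w) \<le> b [j] \<and> b [j] \<le> b (j # w)" if "w \<in> S j" for w
      using t[OF \<open>j \<in> ?J\<close> that] meet[OF \<open>i \<in> ?J\<close> \<open>j \<in> ?J\<close> \<open>i \<noteq> j\<close> that] \<open>b [i] \<le> b [j]\<close> \<open>b [j] < t j\<close>
      by linarith
  qed simp
  have left: ?case if "i \<in> ?J" "j \<in> ?J" "i \<noteq> j" "t i < a [i]" "t j < a [j]" "a [j] \<le> a [i]" for i j
  proof (rule good[OF that(2), of "a [j]"])
    show "a [j] \<le> b [j]" using Suc.prems(1) singleton_words that by blast
    show "a (j # w) \<le> a [j] \<and> a [j] \<le> b (j # w)" if "w \<in> S j" for w
      using t[OF \<open>j \<in> ?J\<close> that] meet[OF \<open>i \<in> ?J\<close> \<open>j \<in> ?J\<close> \<open>i \<noteq> j\<close> that] \<open>a [j] \<le> a [i]\<close> \<open>t j < a [j]\<close>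
      by linarith
  qed simp
  have in_J: "0 \<in> ?J" "1 \<in> ?J" "2 \<in> ?J" by auto
  have trich: "t j < a [j] \<or> b [j] < t j \<or> ?case" if "j \<in> ?J" for j
    using good[OF that, of "t j"] t[OF that] by (meson not_le)
  have two_right: ?case if "i \<in> ?J" "j \<in> ?J" "i \<noteq> j" "b [i] < t i" "b [j] < t j" for i j
    by (cases "b [i] \<le> b [j]") (use right[of i j] right[of j i] that in simp_all)
  have two_left: ?case if "i \<in> ?J" "j \<in> ?J" "i \<noteq> j" "t i < a [i]" "t j < a [j]" for i j
    by (cases "a [j] \<le> a [i]") (use left[of i j] left[of j i] that in simp_all)
  have neq: "(0::nat) \<noteq> 1" "(0::nat) \<noteq> 2" "(1::nat) \<noteq> 2" by auto
  show ?case
    using trich[OF in_J(1)] trich[OF in_J(2)] trich[OF in_J(3)]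
      two_right[OF in_J(1,2) neq(1)] two_right[OF in_J(1,3) neq(2)] two_right[OF in_J(2,3) neq(3)]
      two_left[OF in_J(1,2) neq(1)] two_left[OF in_J(1,3) neq(2)] two_left[OF in_J(2,3) neq(3)]
    by argo
qed

text \<open>
  In a tree order, what is comparable to some \<open>x\<^sub>i\<close> below \<open>x\<^sub>j\<close> is comparable to \<open>x\<^sub>j\<close>.
\<close>

lemma indep_words_chain:
  fixes L :: "nat list \<Rightarrow> nat list \<Rightarrow> bool"
  assumes "\<And>u. u \<in> words k \<Longrightarrow> L u u"
    and "\<And>u v w. L u v \<Longrightarrow> L v w \<Longrightarrow> L u w"
    and "\<And>u v w. L u v \<Longrightarrow> L u w \<Longrightarrow> L v w \<or> L w v"
    and "\<And>u v. u \<in> words k \<Longrightarrow> v \<in> words k \<Longrightarrow> adj u v \<Longrightarrow> L u v \<or> L v u"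
  shows "\<exists>S. indep_words k S \<and> (\<forall>u \<in> S. \<forall>v \<in> S. L u v \<or> L v u)"
  using assms
proof (induction k arbitrary: L)
  case 0
  then show ?case by (intro exI[of _ "{}"]) (auto simp: indep_words_def)
next
  case (Suc k)
  \<comment> \<open>\<open>L u v\<close> reads: \<open>v\<close> equals \<open>u\<close> or is an
    ancestor of \<open>u\<close>.\<close>
  have step: ?case if ij: "i \<in> {0, 1, 2}" "j \<in> {0, 1, 2}" "i \<noteq> j" and Lij: "L [i] [j]" for i j
  proof -
    obtain S where S: "indep_words k S" "\<forall>u \<in> S. \<forall>v \<in> S. L (j # u) (j # v) \<or> L (j # v) (j # u)"
    proof (atomize_elim, rule Suc.IH[of "\<lambda>u v. L (j # u) (j # v)"])
      show "L (j # u) (j # u)" if "u \<in> words k" for u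
        using Suc.prems(1) Cons_words that ij by blast
      show "L (j # u) (j # w)" if "L (j # u) (j # v)" "L (j # v) (j # w)" for u v w
        using Suc.prems(2) that by blast
      show "L (j # v) (j # w) \<or> L (j # w) (j # v)" if "L (j # u) (j # v)" "L (j # u) (j # w)" for u v w
        using Suc.prems(3) that by blast
      show "L (j # u) (j # v) \<or> L (j # v) (j # u)" if "u \<in> words k" "v \<in> words k" "adj u v" for u v
        using Suc.prems(4) Cons_words that ij by simp
    qed
    have jw: "L [j] (j # w) \<or> L (j # w) [j]" if "w \<in> S" for w
    proof -
      have "w \<in> words k" using S that by (auto simp: indep_words_def)
      then have "L [i] (j # w) \<or> L (j # w) [i]"
        using Suc.prems(4)[of "[i]" "j # w"] Cons_words singleton_words ij by auto
      \<comment> \<open>If \<open>j # w\<close> is above \<open>[i]\<close>, it and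
        \<open>[j]\<close> are both above \<open>[i]\<close>, hence comparable; if it is below
        \<open>[i]\<close>, transitivity puts it below \<open>[j]\<close>.\<close>
      then show ?thesis using Suc.prems(2,3) Lij by blast
    qed
    have "L [j] [j]" using Suc.prems(1) singleton_words ij by blast
    then show ?thesis using indep_words_Suc[OF S(1) ij(2)] S(2) jw
      by (intro exI[of _ "insert [j] ((#) j ` S)"]) auto
  qed
  have "L [0] [1] \<or> L [1] [0]" using Suc.prems(4)[of "[0]" "[1]"] singleton_words[of _ k] by auto
  then show ?case using step[of 0 1] step[of 1 0] by auto
qed

section \<open>The graphs \<open>G_k\<close> on natural numbers\<close>

definition word_graph :: "nat \<Rightarrow> nat graph" where
  "word_graph k = (list_encode ` words k,
     {{list_encode u, list_encode v} |u v. u \<in> words k \<and> v \<in> words k \<and> adj u v})"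

lemma verts_word_graph [simp]: "verts (word_graph k) = list_encode ` words k"
  by (simp add: word_graph_def)

lemma edge_word_graph:
  assumes "u \<in> words k" "v \<in> words k"
  shows "{list_encode u, list_encode v} \<in> edges (word_graph k) \<longleftrightarrow> adj u v"
  using assms by (auto simp: word_graph_def doubleton_eq_iff list_encode_eq intro: adj_sym)

lemma fin_graph_word_graph: "fin_graph (word_graph k)"
  unfolding fin_graph_def
  by (auto simp: finite_words word_graph_def nsets_def card_2_iff list_encode_eq doubleton_eq_iff)
     (metis adj_irrefl list_encode_eq)

lemma word_graph_in_word_graphs: "word_graph k \<in> word_graphs"
proof -
  have "word_labelling list_decode (word_graph k)"
    using edge_word_graph by (auto simp: word_labelling_def inj_on_def words_def)
  then show ?thesis using fin_graph_word_graph by (auto simp: word_graphs_def)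
qed

lemma indep_words_alpha:
  assumes "indep_words k S" "list_encode ` S \<subseteq> X"
  shows "k \<le> alpha (induced (word_graph k) X)"
proof -
  have "S \<subseteq> words k" "card S = k" "\<forall>u \<in> S. \<forall>v \<in> S. \<not> adj u v"
    using assms by (auto simp: indep_words_def)
  then have "indep (list_encode ` S) (edges (induced (word_graph k) X))"
    using edge_word_graph by (auto simp: indep_def subset_iff)
  then have "card (list_encode ` S) \<le> alpha (induced (word_graph k) X)"
    using assms by (intro card_le_alpha) (auto simp: finite_words indep_words_def)
  then show ?thesis using assms by (simp add: card_image inj_list_encode indep_words_def)
qed

lemma word_graphs_width:
  assumes "width P" "G \<in> word_graphs"
  shows "P G (2 * omega G)"
  using width.width_le_twice_omega[OF assms(1)] assms(2) unfolding word_graphs_def by blast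

section \<open>Lower bounds for \<open>alpha_pw\<close> and \<open>alpha_td\<close>\<close>

lemma alpha_pw_word_graph: "k \<le> alpha_pw (word_graph k)"
proof -
  let ?G = "word_graph k"
  have "pw_le ?G (2 * omega ?G)"
    using word_graphs_width[OF pw.width_axioms word_graph_in_word_graphs] .
  then have ne: "{B. path_decomp ?G B} \<noteq> {}" by (auto simp: pw_le_def)
  show ?thesis unfolding alpha_pw_def
  proof (rule cINF_greatest[OF ne])
    fix B assume "B \<in> {B. path_decomp ?G B}"
    then have B: "path_decomp ?G B" by simp
    have "\<exists>a b. a \<le> b \<and> b < length B \<and> {i. i < length B \<and> v \<in> B ! i} = {a..b}"
      if "v \<in> verts ?G" for v
      using B that unfolding path_decomp_def by blast
    then obtain a b where ab: "\<And>v. v \<in> verts ?G \<Longrightarrow>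
        a v \<le> b v \<and> b v < length B \<and> {i. i < length B \<and> v \<in> B ! i} = {a v..b v}"
      by metis
    have mem: "i < length B \<and> v \<in> B ! i \<longleftrightarrow> a v \<le> i \<and> i \<le> b v" if "v \<in> verts ?G" for v i
      using ab[OF that] by (auto simp: set_eq_iff)
    have "\<exists>S t. indep_words k S \<and> (\<forall>w \<in> S. a (list_encode w) \<le> t \<and> t \<le> b (list_encode w))"
    proof (rule indep_words_interval)
      show "a (list_encode w) \<le> b (list_encode w)" if "w \<in> words k" for w
        using ab that by simp
      fix u v assume uv: "u \<in> words k" "v \<in> words k" "adj u v"
      then obtain X where "X \<in> set B" "{list_encode u, list_encode v} \<subseteq> X"
        using B edge_word_graph[of u k v] unfolding path_decomp_def by blast
      \<comment> \<open>An edge lies in a common bag \<open>i\<close>, and \<open>i\<close>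
        separates the left end of one interval from the right end of the other.\<close>
      then obtain i where "i < length B" "list_encode u \<in> B ! i" "list_encode v \<in> B ! i"
        by (auto simp: in_set_conv_nth)
      then show "a (list_encode u) \<le> b (list_encode v)"
        using mem[of "list_encode u" i] mem[of "list_encode v" i] uv by fastforce
    qed
    then obtain S t where S: "indep_words k S"
      "\<And>w. w \<in> S \<Longrightarrow> a (list_encode w) \<le> t \<and> t \<le> b (list_encode w)" by blast
    obtain X where X: "X \<in> set B" "list_encode ` S \<subseteq> X"
    proof (cases "S = {}")
      \<comment> \<open>Here \<open>k = 0\<close> and \<open>t\<close> is unconstrained, possibly
        outside the list, so any bag is taken.\<close>
      case True
      then show ?thesis using that[of "hd B"] B by (auto simp: path_decomp_def)
    next
      case False
      have "t < length B \<and> list_encode w \<in> B ! t" if "w \<in> S" for w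
        using mem[of "list_encode w" t] S that by (auto simp: indep_words_def)
      then have "B ! t \<in> set B" "list_encode ` S \<subseteq> B ! t" using False by auto
      then show ?thesis by (rule that)
    qed
    have "k \<le> alpha (induced ?G X)" using indep_words_alpha S(1) X(2) .
    then show "k \<le> (MAX X \<in> set B. alpha (induced ?G X))"
      using X(1) by (meson List.finite_set Max_ge dual_order.trans finite_imageI image_eqI)
  qed
qed

lemma alpha_td_word_graph: "k \<le> alpha_td (word_graph k)"
proof -
  let ?G = "word_graph k"
  have "td_le ?G (2 * omega ?G)"
    using word_graphs_width[OF td.width_axioms word_graph_in_word_graphs] .
  then have ne: "{R. td_decomp ?G R} \<noteq> {}" by (auto simp: td_le_def)
  show ?thesis unfolding alpha_td_def
  proof (rule cINF_greatest[OF ne])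
    fix R assume "R \<in> {R. td_decomp ?G R}"
    then have rf: "rooted_forest (verts ?G) R"
      and e: "edges ?G \<subseteq> edges (forest_closure (verts ?G) R)"
      by (auto simp: td_decomp_def)
    have finV: "finite (verts ?G)" by (simp add: finite_words)
    have sv: "single_valued R" using rf by (simp add: rooted_forest_def)
    let ?L = "\<lambda>u v. (list_encode u, list_encode v) \<in> R\<^sup>*"
    have "\<exists>S. indep_words k S \<and> (\<forall>u \<in> S. \<forall>v \<in> S. ?L u v \<or> ?L v u)"
    proof (rule indep_words_chain)
      fix u v assume uv: "u \<in> words k" "v \<in> words k" "adj u v"
      then obtain Q where "root_leaf_path (verts ?G) R Q"
        "{list_encode u, list_encode v} \<in> [set Q]\<^bsup>2\<^esup>"
        using e edge_word_graph[of u k v] unfolding forest_closure_def by auto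
      then show "?L u v \<or> ?L v u"
        using successively_comparable[of R Q] by (auto simp: root_leaf_path_def nsets_def)
    next
      \<comment> \<open>Parents are unique, so the ancestors of a vertex form a chain.\<close>
      show "?L v w \<or> ?L w v" if "?L u v" "?L u w" for u v w
        using single_valued_confluent[OF sv that] .
    qed (simp, erule (1) rtrancl_trans)
    then obtain S where S: "indep_words k S" "\<And>u v. u \<in> S \<Longrightarrow> v \<in> S \<Longrightarrow> ?L u v \<or> ?L v u" by blast
    show "k \<le> (SUP Q \<in> {Q. root_leaf_path (verts ?G) R Q}. alpha (induced ?G (set Q)))"
    proof (cases "S = {}")
      case True
      then show ?thesis using S by (simp add: indep_words_def)
    next
      case False
      have SV: "S \<subseteq> words k" using S by (simp add: indep_words_def)
      \<comment> \<open>\<open>S\<close> is a chain, so all its members are ancestors of its lowest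
        element \<open>x\<close> or \<open>x\<close> itself. A suitable root-to-leaf path through
        \<open>x\<close> then contains \<open>S\<close>.\<close>
      obtain x where x: "x \<in> S" "\<And>w. w \<in> S \<Longrightarrow> ?L x w"
      proof -
        obtain z where z: "z \<in> list_encode ` S" "\<And>y. (y, z) \<in> R\<^sup>+ \<Longrightarrow> y \<notin> list_encode ` S"
          using wfE_min'[OF wf_trancl[OF rooted_forest_wf(1)[OF finV rf]], of "list_encode ` S"] False
          by blast
        then obtain x where x: "x \<in> S" "\<And>y. (y, list_encode x) \<in> R\<^sup>+ \<Longrightarrow> y \<notin> list_encode ` S"
          by blast
        have "?L x w" if "w \<in> S" for w
          using S(2)[OF x(1) that] x(2)[of "list_encode w"] that by (auto simp: rtrancl_eq_or_trancl)
        then show ?thesis using that x(1) by blast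
      qed
      have "list_encode x \<in> verts ?G" using x(1) SV by auto
      then obtain Q where Q: "root_leaf_path (verts ?G) R Q"
        "{y. (list_encode x, y) \<in> R\<^sup>*} \<subseteq> set Q"
        using root_leaf_path_exists[OF finV rf] by blast
      have "list_encode ` S \<subseteq> set Q" using Q(2) x(2) by auto
      then have "k \<le> alpha (induced ?G (set Q))" by (rule indep_words_alpha[OF S(1)])
      also have "\<dots> \<le> (SUP Q \<in> {Q. root_leaf_path (verts ?G) R Q}. alpha (induced ?G (set Q)))"
        using Q(1) finite_root_leaf_image[OF finV, of "\<lambda>X. alpha (induced ?G X)" R]
        by (intro cSUP_upper bdd_above_finite) auto
      finally show ?thesis .
    qed
  qed
qed

section \<open>The class that separates both parameters\<close>

lemma word_graphs_clique_bounded: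
  assumes "\<And>G. G \<in> word_graphs \<Longrightarrow> \<rho> G \<le> 2 * omega G"
  shows "has_clique_bounded \<rho> word_graphs"
  unfolding has_clique_bounded_def
  using assms induced_subgraph_word_graphs
  by (intro exI[of _ "\<lambda>n. 2 * n"]) (auto simp: mono_def)

lemma word_graphs_unbounded:
  assumes "\<And>k. k \<le> \<sigma> (word_graph k)"
  shows "\<not> has_bounded \<sigma> word_graphs"
proof
  assume "has_bounded \<sigma> word_graphs"
  then obtain c where c: "\<And>G H. G \<in> word_graphs \<Longrightarrow> induced_subgraph H G \<Longrightarrow> \<sigma> H \<le> c"
    by (auto simp: has_bounded_def)
  have "induced_subgraph (word_graph (Suc c)) (word_graph (Suc c))"
    unfolding induced_subgraph_def using induced_verts[OF fin_graph_word_graph] by (metis subset_refl)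
  then show False using c[OF word_graph_in_word_graphs] assms[of "Suc c"] by fastforce
qed

theorem theorem4p5:
  shows "\<forall>(\<rho>, \<alpha>\<rho>) \<in> {(td, alpha_td), (pw, alpha_pw)}.
    awful \<rho> \<alpha>\<rho> \<and>
    (\<exists>\<G>. graph_class \<G> \<and> has_clique_bounded \<rho> \<G> \<and> \<not> has_bounded \<alpha>\<rho> \<G>)"
proof -
  have td: "has_clique_bounded td word_graphs" "\<not> has_bounded alpha_td word_graphs"
    by (rule word_graphs_clique_bounded, rule td_leI, erule word_graphs_width[OF td.width_axioms])
       (rule word_graphs_unbounded, rule alpha_td_word_graph)
  have pw: "has_clique_bounded pw word_graphs" "\<not> has_bounded alpha_pw word_graphs"
    by (rule word_graphs_clique_bounded, rule pw_leI, erule word_graphs_width[OF pw.width_axioms])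
       (rule word_graphs_unbounded, rule alpha_pw_word_graph)
  show ?thesis using td pw graph_class_word_graphs unfolding awesome_def by auto
qed

end
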